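(* Let $k>1$ and $s\ge 1$ be integers with $s\le\lfloor k/2\rfloor$. Then for all integers $n\ge 0$: \begin{align*} p_{[1,2;-(3^{k}-b)/b]}\left(3^{2s} n+3^{2s-1} r+\frac{3^{2s}-1}{8}\right)&\equiv 0 \pmod{3^{k-2s+1}}, && r\in\{1,2\},\\ p_{[1,2;-(5^{k}-b)/b]}\left(5^{2s} n+5^{2s-1} r+\frac{5^{2s}-1}{8}\right)&\equiv 0 \pmod{5^{k-2s+1}}, && r\in\{1,2,3,4\},\\ p_{[1,2;-(7^{k}-b)/b]}\left(7^{2s} n+7^{2s-1} r+\frac{7^{2s}-1}{8}\right)&\equiv 0 \pmod{7^{k-2s+1}}, && r\in\{1,2,\ldots,6\},\\ p_{[1,3;-(5^{k}-b)/b]}\left(5^{2s} n+5^{2s-1} r+\frac{5^{2s}-1}{6}\right)&\equiv 0 \pmod{5^{k-2s+1}}, && r\in\{1,2,3,4\},\\ p_{[1,4;-(7^{k}-b)/b]}\left(7^{2s} n+7^{2s-1} r+\frac{11\cdot 7^{2s-1}-5}{24}\right)&\equiv 0 \pmod{7^{k-2s+1}}, && r\in\{0,2,3,\ldots,6\},\\ p_{[1,3;-(11^{k}-b)/b]}\left(11^{2s} n+11^{2s-1} r+\frac{5\cdot 11^{2s-1}-1}{6}\right)&\equiv 0 \pmod{11^{k-2s+1}}, && r\in\{0,2,3,\ldots,10\},\\ p_{[1,4;-(11^{k}-b)/b]}\left(11^{2s} n+11^{2s-1} r+\frac{7\cdot 11^{2s-1}-5}{24}\right)&\equiv 0 \pmod{11^{k-2s+1}},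 && r\in\{0,1,3,4,\ldots,10\}, \end{align*} where in each congruence $b$ is any positive integer coprime to the modulus (i.e. to the prime $3$, $5$, $7$ or $11$ appearing in it).
   Context: For a rational number $t$ and an integer $m>1$, the rational numbers $p_{[1,m;t]}(n)$, $n\ge 0$, are defined by the formal power series identity $\sum_{n\ge 0}p_{[1,m;t]}(n)q^n=\prod_{j\ge 1}\big((1-q^j)(1-q^{mj})\big)^t$, where each power is the binomial series with constant term $1$. For a prime $\ell$ not dividing the denominator of $t$, a congruence $p_{[1,m;t]}(N)\equiv 0\pmod{\ell^k}$ means that the numerator of $p_{[1,m;t]}(N)$, written as a reduced fraction, is divisible by $\ell^k$ (the denominator is then coprime to $\ell$). *)

theory Defs
  imports "HOL-Analysis.Analysis"
begin

(* f ^ t for a rational exponent t, meant for series f with constant term 1: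
   the binomial series (1 + X)^t evaluated at X = f - 1. *)
definition fps_ratpow :: "rat fps \<Rightarrow> rat \<Rightarrow> rat fps" where
  "fps_ratpow f t = fps_binomial t oo (f - 1)"

definition p_factor :: "nat \<Rightarrow> rat \<Rightarrow> nat \<Rightarrow> rat fps" where
  "p_factor m t j = fps_ratpow ((1 - fps_X ^ j) * (1 - fps_X ^ (m * j))) t"

(* Infinite product in the metric topology on formal power series, starting at the factor
   with exponent 1. *)
definition p_gf :: "nat \<Rightarrow> rat \<Rightarrow> rat fps" where
  "p_gf m t = (\<Prod>j. p_factor m t (Suc j))"

definition p_coeff :: "nat \<Rightarrow> rat \<Rightarrow> nat \<Rightarrow> rat" where
  "p_coeff m t n = fps_nth (p_gf m t) n"

(* x is congruent to 0 modulo l ^ k in the sense that l ^ k divides the numerator of the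
   reduced fraction x (quotient_of returns coprime numerator and denominator). *)
definition cong_zero_pow :: "rat \<Rightarrow> nat \<Rightarrow> nat \<Rightarrow> bool" where
  "cong_zero_pow x l k \<longleftrightarrow> int l ^ k dvd fst (quotient_of x)"

(* prodinf is an unspecified value for divergent products; here the product converges. *)
lemma p_factor_has_prod:
  assumes "m > 0"
  shows "(\<lambda>j. p_factor m t (Suc j)) has_prod p_gf m t"
proof -
  define f where "f = (\<lambda>j. p_factor m t (Suc j))"
  have f0: "fps_nth (f j) 0 = 1" for j
    by (simp add: f_def p_factor_def fps_ratpow_def fps_binomial_def)
  have fk: "fps_nth (f j) i = 0" if "0 < i" "i \<le> j" for i j
  proof -
    define g where "g = (1 - fps_X ^ Suc j) * (1 - fps_X ^ (m * Suc j)) - (1 :: rat fps)"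
    have g: "g = fps_X ^ Suc j * (fps_X ^ (m * Suc j) - 1 - fps_X ^ (m * Suc j - Suc j))"
    proof -
      have "Suc j + (m * Suc j - Suc j) = m * Suc j"
        using assms by (cases m) auto
      hence "fps_X ^ Suc j * fps_X ^ (m * Suc j - Suc j) = (fps_X ^ (m * Suc j) :: rat fps)"
        by (metis power_add)
      thus ?thesis
        unfolding g_def right_diff_distrib by (simp add: algebra_simps del: power_Suc mult_Suc_right)
    qed
    have "fps_nth (g ^ n) i = 0" if n0: "n > 0" for n
    proof -
      obtain n' where n: "n = Suc n'"
        using n0 gr0_implies_Suc by blast
      have "g ^ n = fps_X ^ Suc j *
          ((fps_X ^ (m * Suc j) - 1 - fps_X ^ (m * Suc j - Suc j)) * g ^ n')"
        unfolding n power_Suc[of g] by (subst g) (simp only: mult.assoc)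
      thus ?thesis
        using \<open>i \<le> j\<close> by (simp only: fps_X_power_mult_nth) simp
    qed
    hence "fps_nth (fps_binomial t) n * fps_nth (g ^ n) i = 0" for n
      using \<open>0 < i\<close> by (cases "n = 0") auto
    thus ?thesis
      unfolding f_def p_factor_def fps_ratpow_def fps_compose_nth g_def [symmetric]
      by (intro sum.neutral) blast
  qed
  define P where "P = Abs_fps (\<lambda>n. fps_nth (\<Prod>j\<le>n. f j) n)"
  have stable: "fps_nth (\<Prod>j\<le>N. f j) n = fps_nth (\<Prod>j\<le>n. f j) n" if "n \<le> N" for n N
    using that
  proof (induction N rule: dec_induct)
    case (step N)
    have "fps_nth ((\<Prod>j\<le>N. f j) * f (Suc N)) n =
            (\<Sum>i=0..n. fps_nth (\<Prod>j\<le>N. f j) i * fps_nth (f (Suc N)) (n - i))"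
      by (simp add: fps_mult_nth)
    also have "\<dots> = (\<Sum>i=0..n. if i = n then fps_nth (\<Prod>j\<le>N. f j) i else 0)"
      using step.hyps by (intro sum.cong) (auto simp: f0 fk)
    finally show ?case
      using step.IH by simp
  qed auto
  have "(\<lambda>N. \<Prod>j\<le>N. f j) \<longlonglongrightarrow> P"
  proof (rule tendsto_fpsI)
    fix n
    show "eventually (\<lambda>N. fps_nth (\<Prod>j\<le>N. f j) n = fps_nth P n) sequentially"
      using eventually_ge_at_top[of n] by eventually_elim (unfold P_def fps_nth_Abs_fps, rule stable)
  qed
  moreover have "fps_nth P 0 = 1"
    by (simp add: P_def f0)
  hence "P \<noteq> 0"
    by auto
  ultimately have "f has_prod P"
    by (simp add: has_prod_def raw_has_prod_def)
  hence "f has_prod prodinf f"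
    using has_prod_unique[of f P] by (simp only:)
  thus ?thesis
    unfolding p_gf_def f_def .
qed

end

(* Write t = 1 - l^k / b and f_m = prod_j (1 - q^(m j)), so that the generating function is
   f_1 f_m A^(l^k), where A is the (-1/b)-th power of f_1 f_m and is l-integral. The i-th coefficient
   of A^(l^k) is divisible by l^k up to the power of l dividing i, hence by l^(k - 2 s + 1)
   unless l^(2 s) divides i. It remains to see that f_1 f_m has vanishing coefficients in the
   given residue classes modulo l^(2 s). By the pentagonal number theorem its i-th coefficient
   vanishes unless 24 i + 1 + m = x^2 + m y^2; in the given classes the left side has odd
   l-adic valuation, which is impossible when -m is a nonresidue modulo l. Only for m = 2 and l = 3
   this form is isotropic; there 8 i + 1 = x^2 + y^2 does the job, coming from two of Gauss's theta series.
   All theta expansions are instances of the Jacobi triple product, obtained from a finite version. *)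

theory Submission
  imports Defs
begin

section \<open>Integrality at a prime\<close>

text \<open>For a prime \<open>l\<close> this is the ring of integers localized at \<open>l\<close>.
  The fraction \<open>c / d\<close> need not be reduced, so sums and products only multiply
  denominators.\<close>

definition localized_ints :: "nat \<Rightarrow> rat set" where
  "localized_ints l = {x. \<exists>c d. coprime d (int l) \<and> d \<noteq> 0 \<and> x * of_int d = of_int c}"

lemma of_int_in_localized_ints [simp]: "of_int c \<in> localized_ints l"
proof -
  have "coprime 1 (int l) \<and> (1::int) \<noteq> 0 \<and> (of_int c :: rat) * of_int 1 = of_int c" by simp
  thus ?thesis unfolding localized_ints_def by blast
qed

lemma localized_ints_simps [simp]:
  "0 \<in> localized_ints l" "1 \<in> localized_ints l" "of_nat n \<in> localized_ints l"
  using of_int_in_localized_ints[of 0 l] of_int_in_localized_ints[of 1 l]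
    of_int_in_localized_ints[of "int n" l] by simp_all

lemma localized_ints_mult [intro]:
  assumes "x \<in> localized_ints l" "y \<in> localized_ints l"
  shows "x * y \<in> localized_ints l"
proof -
  obtain c d c' d' where "coprime d (int l)" "d \<noteq> 0" "x * of_int d = of_int c"
      "coprime d' (int l)" "d' \<noteq> 0" "y * of_int d' = of_int c'"
    using assms unfolding localized_ints_def by blast
  hence "coprime (d * d') (int l) \<and> d * d' \<noteq> 0 \<and> x * y * of_int (d * d') = of_int (c * c')"
    by (auto simp: algebra_simps) (metis mult.assoc mult.commute)
  thus ?thesis unfolding localized_ints_def by blast
qed

lemma localized_ints_add [intro]:
  assumes "x \<in> localized_ints l" "y \<in> localized_ints l"
  shows "x + y \<in> localized_ints l"
proof -
  obtain c d c' d' where *: "coprime d (int l)" "d \<noteq> 0" "x * of_int d = of_int c"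
      "coprime d' (int l)" "d' \<noteq> 0" "y * of_int d' = of_int c'"
    using assms unfolding localized_ints_def by blast
  have "(x + y) * of_int (d * d') = (x * of_int d) * of_int d' + (y * of_int d') * of_int d"
    by (simp add: algebra_simps)
  also have "\<dots> = of_int (c * d' + c' * d)"
    by (simp add: *)
  finally have "coprime (d * d') (int l) \<and> d * d' \<noteq> 0 \<and>
      (x + y) * of_int (d * d') = of_int (c * d' + c' * d)"
    using * by simp
  thus ?thesis unfolding localized_ints_def by blast
qed

lemma localized_ints_uminus [intro]: "x \<in> localized_ints l \<Longrightarrow> - x \<in> localized_ints l"
  using localized_ints_mult[of "-1" l x] of_int_in_localized_ints[of "-1" l] by simp

lemma localized_ints_diff [intro]:
  "x \<in> localized_ints l \<Longrightarrow> y \<in> localized_ints l \<Longrightarrow> x - y \<in> localized_ints l"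
  using localized_ints_add[of x l "-y"] by auto

lemma localized_ints_sum [intro]:
  "(\<And>i. i \<in> A \<Longrightarrow> f i \<in> localized_ints l) \<Longrightarrow> sum f A \<in> localized_ints l"
  by (induction A rule: infinite_finite_induct) auto

lemma localized_ints_divide:
  assumes "x \<in> localized_ints l" "coprime d (int l)" "d \<noteq> 0"
  shows "x / of_int d \<in> localized_ints l"
proof -
  have "coprime d (int l) \<and> d \<noteq> 0 \<and> (1 / of_int d :: rat) * of_int d = of_int 1"
    using assms by simp
  hence "1 / of_int d \<in> localized_ints l"
    unfolding localized_ints_def by blast
  with assms(1) have "x * (1 / of_int d) \<in> localized_ints l" by blast
  thus ?thesis by simp
qed

text \<open>Clearing both denominators in \<open>x = p / q\<close> gives
  \<open>p * d = l ^ e * c * q\<close>. As \<open>d\<close> is coprime to \<open>l\<close>, the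
  whole power divides the reduced numerator \<open>p\<close>.\<close>

lemma cong_zero_powI:
  assumes "x = of_nat (l ^ e) * y" "y \<in> localized_ints l"
  shows "cong_zero_pow x l e"
proof -
  obtain c d where cd: "coprime d (int l)" "d \<noteq> 0" "y * of_int d = of_int c"
    using assms(2) unfolding localized_ints_def by blast
  obtain p q where pq: "quotient_of x = (p, q)" by fastforce
  have q: "q > 0" and x: "x = of_int p / of_int q"
    using quotient_of_denom_pos[OF pq] quotient_of_div[OF pq] by auto
  have "of_int (p * d) = x * of_int q * of_int d"
    using q by (simp add: x)
  also have "\<dots> = of_nat (l ^ e) * (y * of_int d) * of_int q"
    by (simp add: assms(1))
  also have "\<dots> = of_int (int l ^ e * c * q)"
    by (simp add: cd)
  finally have "p * d = int l ^ e * c * q"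
    by (simp only: of_int_eq_iff)
  hence "int l ^ e dvd p * d" by simp
  moreover have "coprime (int l ^ e) d"
    using cd(1) by (simp add: coprime_commute)
  ultimately have "int l ^ e dvd p"
    by (simp add: coprime_dvd_mult_left_iff)
  thus ?thesis
    by (simp add: cong_zero_pow_def pq)
qed

text \<open>The exponent is approximated \<open>l\<close>-adically by a natural number, for which the binomial
  coefficient is an integer.\<close>

lemma gbinomial_in_localized_ints:
  assumes l: "prime l" and x: "x \<in> localized_ints l"
  shows "x gchoose n \<in> localized_ints l"
proof -
  \<comment> \<open>Dividing by \<open>fact n\<close> loses exactly the factor \<open>l ^ K\<close>,
    so this is the precision to which \<open>x\<close> is approximated.\<close>
  define K where "K = multiplicity l (fact n)"
  obtain u :: nat where u: "fact n = l ^ K * u" "\<not> l dvd u"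
    unfolding K_def using l multiplicity_decompose'[of "fact n" l]
    by (metis fact_nonzero not_prime_unit)
  obtain c d where cd: "coprime d (int l)" "d \<noteq> 0" "x * of_int d = of_int c"
    using x unfolding localized_ints_def by blast
  have "coprime d (int l ^ K)" using cd(1) by simp
  then obtain d' v where d': "d' * d + v * int l ^ K = 1"
    using bezout_int[of d "int l ^ K"] by auto
  \<comment> \<open>\<open>d'\<close> inverts \<open>d\<close> modulo \<open>l ^ K\<close>, so
    \<open>a\<close> is a natural number congruent to \<open>x = c / d\<close> there.\<close>
  define a where "a = nat ((c * d') mod (int l ^ K))"
  have lpos: "int l ^ K > 0" using l by (simp add: prime_gt_0_nat)
  have "int l ^ K dvd c * d' - int a"
    using lpos by (simp add: a_def)
  moreover have "c - int a * d = (c * d' - int a) * d + int l ^ K * (c * v)"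
  proof -
    have "c = c * (d' * d + v * int l ^ K)" by (simp add: d')
    thus ?thesis by (simp add: algebra_simps)
  qed
  ultimately have "int l ^ K dvd c - int a * d" by simp
  then obtain w where w: "c - int a * d = int l ^ K * w" by (rule dvdE)
  define y where "y = of_int w / (of_int d :: rat)"
  have y: "y \<in> localized_ints l"
    unfolding y_def using cd by (intro localized_ints_divide) auto
  have "x * of_int d = (of_nat a + of_nat (l ^ K) * y) * of_int d"
  proof -
    have "c = int a * d + int l ^ K * w" using w by simp
    hence "of_int c = (of_int (int a * d + int l ^ K * w) :: rat)" by simp
    thus ?thesis using cd by (simp add: y_def algebra_simps)
  qed
  hence xa: "x = of_nat a + of_nat (l ^ K) * y" using cd(2) by simp
  have prod: "\<exists>z \<in> localized_ints l.
      (\<Prod>i = 0..<m. x - of_nat i) = (\<Prod>i = 0..<m. of_nat a - of_nat i) + of_nat (l ^ K) * z" for m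
  proof (induction m)
    case 0
    show ?case by (intro bexI[of _ 0]) auto
  next
    case (Suc m)
    then obtain z where z: "z \<in> localized_ints l"
      "(\<Prod>i = 0..<m. x - of_nat i) = (\<Prod>i = 0..<m. of_nat a - of_nat i) + of_nat (l ^ K) * z"
      by blast
    have "(\<Prod>i = 0..<m. of_nat a - of_nat i :: rat) = of_int (\<Prod>i = 0..<m. int a - int i)"
      by simp
    hence P: "(\<Prod>i = 0..<m. of_nat a - of_nat i :: rat) \<in> localized_ints l"
      by (simp only: of_int_in_localized_ints)
    show ?case
    proof (rule bexI)
      show "(\<Prod>i = 0..<Suc m. x - of_nat i) = (\<Prod>i = 0..<Suc m. of_nat a - of_nat i) +
          of_nat (l ^ K) * ((\<Prod>i = 0..<m. of_nat a - of_nat i) * y + z * (x - of_nat m))"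
      proof -
        define A where "A = (\<Prod>i = 0..<m. of_nat a - of_nat i :: rat)"
        have "x - of_nat m = of_nat a - of_nat m + of_nat (l ^ K) * y"
          by (simp add: xa)
        hence "A * (x - of_nat m) = A * (of_nat a - of_nat m) + of_nat (l ^ K) * (A * y)"
          by (simp only:) (simp add: algebra_simps)
        thus ?thesis
          by (simp add: z(2) prod.atLeast0_lessThan_Suc distrib_left distrib_right mult_ac flip: A_def)
      qed
      show "(\<Prod>i = 0..<m. of_nat a - of_nat i) * y + z * (x - of_nat m) \<in> localized_ints l"
        using P y z(1) x
        by (intro localized_ints_add localized_ints_mult localized_ints_diff localized_ints_simps)
    qed
  qed
  then obtain z where z: "z \<in> localized_ints l"
      "(\<Prod>i = 0..<n. x - of_nat i) = (\<Prod>i = 0..<n. of_nat a - of_nat i) + of_nat (l ^ K) * z"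
    by blast
  have "fact n * (x gchoose n) = fact n * of_nat (a choose n) + of_nat (l ^ K) * z"
    by (simp only: gbinomial_mult_fact z(2) binomial_gbinomial)
  also have "(fact n :: rat) = of_nat (l ^ K) * of_nat u"
    using u(1) by (metis of_nat_fact of_nat_mult)
  finally have "of_nat (l ^ K) * (of_nat u * (x gchoose n)) =
      of_nat (l ^ K) * (of_nat u * of_nat (a choose n) + z)"
    by (simp add: algebra_simps)
  hence *: "of_nat u * (x gchoose n) = of_nat u * of_nat (a choose n) + z"
    using l by simp
  have "u \<noteq> 0" using u(2) by (metis dvd_0_right)
  hence "x gchoose n = of_nat (a choose n) + z / of_int (int u)"
    using * by (simp add: field_simps)
  moreover have "z / of_int (int u) \<in> localized_ints l"
  proof (rule localized_ints_divide[OF z(1)])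
    show "coprime (int u) (int l)"
      using l u(2) by (simp add: prime_imp_coprime coprime_commute)
    show "int u \<noteq> 0" using \<open>u \<noteq> 0\<close> by simp
  qed
  ultimately show ?thesis by auto
qed

section \<open>Power series with coefficients integral at a prime\<close>

definition localized_fps :: "nat \<Rightarrow> rat fps set" where
  "localized_fps l = {f. \<forall>n. fps_nth f n \<in> localized_ints l}"

lemma localized_fps_nth: "f \<in> localized_fps l \<Longrightarrow> fps_nth f n \<in> localized_ints l"
  by (simp add: localized_fps_def)

lemma localized_fps_one [simp]: "1 \<in> localized_fps l"
  by (simp add: localized_fps_def)

lemma localized_fps_X_power [simp]: "fps_X ^ n \<in> localized_fps l"
  by (simp add: localized_fps_def fps_X_power_nth)

lemma localized_fps_diff: "f \<in> localized_fps l \<Longrightarrow> g \<in> localized_fps l \<Longrightarrow> f - g \<in> localized_fps l"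
  by (auto simp: localized_fps_def)

lemma localized_fps_mult: "f \<in> localized_fps l \<Longrightarrow> g \<in> localized_fps l \<Longrightarrow> f * g \<in> localized_fps l"
  by (auto simp: localized_fps_def fps_mult_nth)

lemma localized_fps_power: "f \<in> localized_fps l \<Longrightarrow> f ^ n \<in> localized_fps l"
  by (induction n) (auto intro: localized_fps_mult)

lemma localized_fps_prod: "(\<And>i. i \<in> A \<Longrightarrow> f i \<in> localized_fps l) \<Longrightarrow> prod f A \<in> localized_fps l"
  by (induction A rule: infinite_finite_induct) (auto intro: localized_fps_mult)

lemma localized_fps_ratpow:
  assumes "prime l" "t \<in> localized_ints l" "f \<in> localized_fps l"
  shows "fps_ratpow f t \<in> localized_fps l"
proof -
  have "(t gchoose i) * fps_nth ((f - 1) ^ i) n \<in> localized_ints l" for i n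
    by (intro localized_ints_mult gbinomial_in_localized_ints localized_fps_nth
        localized_fps_power localized_fps_diff assms localized_fps_one)
  thus ?thesis
    by (auto simp: localized_fps_def fps_ratpow_def fps_compose_nth)
qed

text \<open>Comparing coefficients in \<open>(f ^ l ^ k)' = l ^ k * f ^ (l ^ k - 1) * f'\<close> shows that
  \<open>l ^ k\<close> divides \<open>i\<close> times the \<open>i\<close>-th coefficient.\<close>

lemma nth_prime_power_power:
  assumes l: "prime l" and f: "f \<in> localized_fps l" and i: "\<not> l ^ j dvd i" and jk: "j \<le> k"
  shows "\<exists>z \<in> localized_ints l. fps_nth (f ^ l ^ k) i = of_nat (l ^ (k - j + 1)) * z"
proof -
  from i have i0: "i > 0" by (cases "i = 0") auto
  obtain v u where u: "i = l ^ v * u" "\<not> l dvd u"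
    using l i0 multiplicity_decompose'[of i l] by (metis not_prime_unit less_irrefl)
  have vj: "v < j"
    using i u(1) by (metis dvd_triv_left le_imp_power_dvd not_le dvd_trans)
  define y where "y = fps_nth (fps_deriv f * f ^ (l ^ k - 1)) (i - 1)"
  have "fps_deriv f \<in> localized_fps l"
    using f by (auto simp: localized_fps_def simp del: of_nat_Suc)
  hence y: "y \<in> localized_ints l"
    unfolding y_def using f by (intro localized_fps_nth localized_fps_mult localized_fps_power)
  have "of_nat i * fps_nth (f ^ l ^ k) i = fps_nth (fps_deriv (f ^ l ^ k)) (i - 1)"
    using i0 by simp
  also have "fps_deriv (f ^ l ^ k) = fps_const (of_nat (l ^ k)) * (fps_deriv f * f ^ (l ^ k - 1))"
    by (simp only: fps_deriv_power mult.assoc)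
  finally have "of_nat i * fps_nth (f ^ l ^ k) i = of_nat (l ^ k) * y"
    by (simp only: fps_mult_left_const_nth y_def)
  \<comment> \<open>Here \<open>v\<close> is at most \<open>j - 1\<close>, so cancelling
    \<open>l ^ v\<close> leaves a multiple of \<open>l ^ (k - j + 1)\<close>.\<close>
  moreover have "l ^ k = l ^ v * (l ^ (k - j + 1) * l ^ (j - 1 - v))"
    using vj jk by (simp only: power_add [symmetric]) simp
  ultimately have "of_nat (l ^ v) * (of_nat u * fps_nth (f ^ l ^ k) i) =
      of_nat (l ^ v) * (of_nat (l ^ (k - j + 1)) * (of_nat (l ^ (j - 1 - v)) * y))"
    by (simp only: u(1) of_nat_mult mult.assoc)
  moreover have "(of_nat (l ^ v) :: rat) \<noteq> 0" using l by simp
  ultimately have "of_nat u * fps_nth (f ^ l ^ k) i =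
      of_nat (l ^ (k - j + 1)) * (of_nat (l ^ (j - 1 - v)) * y)"
    using mult_left_cancel by blast
  moreover have u0: "u \<noteq> 0" using u(2) by (metis dvd_0_right)
  ultimately have "fps_nth (f ^ l ^ k) i =
      of_nat (l ^ (k - j + 1)) * (of_nat (l ^ (j - 1 - v)) * y / of_int (int u))"
    by (simp add: field_simps)
  moreover have "of_nat (l ^ (j - 1 - v)) * y / of_int (int u) \<in> localized_ints l"
  proof (rule localized_ints_divide)
    show "of_nat (l ^ (j - 1 - v)) * y \<in> localized_ints l"
      using y localized_ints_simps(3) by blast
    show "coprime (int u) (int l)"
      using l u(2) by (simp add: prime_imp_coprime coprime_commute)
    show "int u \<noteq> 0" using u0 by simp
  qed
  ultimately show ?thesis by blast
qed

section \<open>Reduction of the congruences to vanishing coefficients of Euler products\<close>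

lemma fps_binomial_minus_divide:
  "fps_binomial (1 - of_nat n / of_nat b) =
    (1 + fps_X) * fps_binomial (- 1 / of_nat b :: rat) ^ n"
proof -
  have "1 - of_nat n / of_nat b = 1 + of_nat n * (- 1 / of_nat b :: rat)" by simp
  thus ?thesis
    by (simp only: fps_binomial_add_mult fps_binomial_1 fps_binomial_power)
qed

text \<open>Since \<open>f - 1\<close> has constant term 0, composing with it respects products and
  powers, so the law of exponents for binomial series carries over.\<close>

lemma fps_ratpow_split:
  assumes "fps_nth f 0 = 1"
  shows "fps_ratpow f (1 - of_nat n / of_nat b) = f * fps_ratpow f (- 1 / of_nat b) ^ n"
  using assms unfolding fps_ratpow_def fps_binomial_minus_divide
  by (simp add: fps_compose_mult_distrib fps_compose_power fps_compose_add_distrib)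

text \<open>Kept finite, because a given coefficient depends on finitely many factors only.\<close>

definition euler_prod :: "nat \<Rightarrow> nat \<Rightarrow> rat fps" where
  "euler_prod m n = (\<Prod>j<n. 1 - fps_X ^ (m * Suc j))"

text \<open>Convergence of power series in the metric topology makes each coefficient eventually
  constant.\<close>

lemma p_coeff_partial_product:
  assumes "m > 0"
  shows "\<exists>M0. \<forall>M\<ge>M0. p_coeff m t n = fps_nth (\<Prod>j<M. p_factor m t (Suc j)) n"
proof -
  have "(\<lambda>M. \<Prod>j<M. p_factor m t (Suc j)) \<longlonglongrightarrow> p_gf m t"
    using p_factor_has_prod[OF assms] by (rule has_prod_imp_tendsto')
  hence "eventually (\<lambda>M. fps_nth (\<Prod>j<M. p_factor m t (Suc j)) n = fps_nth (p_gf m t) n) sequentially"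
    unfolding tendsto_fps_iff by blast
  thus ?thesis
    unfolding eventually_sequentially p_coeff_def by metis
qed

lemma prod_p_factor:
  assumes "m > 0"
  shows "(\<Prod>j<M. p_factor m (1 - of_nat n / of_nat b) (Suc j)) =
    euler_prod 1 M * euler_prod m M * (\<Prod>j<M. p_factor m (- 1 / of_nat b) (Suc j)) ^ n"
proof -
  have "p_factor m (1 - of_nat n / of_nat b) (Suc j) =
      (1 - fps_X ^ (1 * Suc j)) * (1 - fps_X ^ (m * Suc j)) * p_factor m (- 1 / of_nat b) (Suc j) ^ n" for j
    unfolding p_factor_def using assms by (subst fps_ratpow_split) auto
  thus ?thesis
    by (simp only: prod.distrib euler_prod_def prod_power_distrib)
qed

text \<open>In the product of \<open>euler_prod 1 M * euler_prod m M\<close> with an \<open>l ^ k\<close>-th power, a term either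
  takes from the power a coefficient whose index is not divisible by \<open>l ^ j\<close>, or from the Euler products one
  whose index is congruent to \<open>N\<close>.\<close>

lemma p_coeff_cong_zero:
  assumes l: "prime l" and m: "m > 0" and b: "b > 0" "coprime b l" and jk: "j \<le> k"
    and van: "\<And>M i. i < M \<Longrightarrow> i \<le> N \<Longrightarrow> l ^ j dvd N - i \<Longrightarrow>
       fps_nth (euler_prod 1 M * euler_prod m M) i = 0"
  shows "cong_zero_pow (p_coeff m (- (of_nat (l ^ k) - of_nat b) / of_nat b) N) l (k - j + 1)"
proof -
  define t where "t = - (of_nat (l ^ k) - of_nat b :: rat) / of_nat b"
  have t: "t = 1 - of_nat (l ^ k) / of_nat b"
    using b by (simp add: t_def field_simps)
  obtain M0 where M0: "\<And>M. M \<ge> M0 \<Longrightarrow>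
      p_coeff m t N = fps_nth (\<Prod>j<M. p_factor m t (Suc j)) N"
    using p_coeff_partial_product[OF m] by blast
  \<comment> \<open>Having more than \<open>N\<close> factors gives \<open>i < M\<close> for every
    index \<open>i\<close> that \<open>van\<close> is applied to.\<close>
  define M where "M = max M0 (Suc N)"
  define F where "F = euler_prod 1 M * euler_prod m M"
  define A where "A = (\<Prod>j<M. p_factor m (- 1 / of_nat b) (Suc j))"
  have "- 1 / of_int (int b) \<in> localized_ints l"
    using b of_int_in_localized_ints[of "-1" l] by (intro localized_ints_divide) auto
  hence "- 1 / of_nat b \<in> localized_ints l" by simp
  hence A: "A \<in> localized_fps l"
    unfolding A_def p_factor_def
    by (intro localized_fps_prod localized_fps_ratpow l localized_fps_mult localized_fps_diff
        localized_fps_one localized_fps_X_power)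
  have "F \<in> localized_fps l"
    unfolding F_def euler_prod_def
    by (intro localized_fps_prod localized_fps_mult localized_fps_diff
        localized_fps_one localized_fps_X_power)
  note F = localized_fps_nth[OF this]
  have "\<forall>i\<in>{0..N}. \<exists>z \<in> localized_ints l.
      fps_nth F i * fps_nth (A ^ l ^ k) (N - i) = of_nat (l ^ (k - j + 1)) * z"
  proof
    fix i assume i: "i \<in> {0..N}"
    show "\<exists>z \<in> localized_ints l.
      fps_nth F i * fps_nth (A ^ l ^ k) (N - i) = of_nat (l ^ (k - j + 1)) * z"
    proof (cases "l ^ j dvd N - i")
      case True
      hence "fps_nth F i = 0"
        unfolding F_def using i by (intro van) (auto simp: M_def)
      thus ?thesis by (intro bexI[of _ 0]) auto
    next
      case False
      then obtain z where "z \<in> localized_ints l"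
          "fps_nth (A ^ l ^ k) (N - i) = of_nat (l ^ (k - j + 1)) * z"
        using nth_prime_power_power[OF l A False jk] by blast
      thus ?thesis
        using F by (intro bexI[of _ "fps_nth F i * z"]) auto
    qed
  qed
  from bchoice[OF this[unfolded Bex_def]]
  obtain z where "\<forall>i\<in>{0..N}. z i \<in> localized_ints l \<and>
      fps_nth F i * fps_nth (A ^ l ^ k) (N - i) = of_nat (l ^ (k - j + 1)) * z i" ..
  hence z: "z i \<in> localized_ints l"
      "fps_nth F i * fps_nth (A ^ l ^ k) (N - i) = of_nat (l ^ (k - j + 1)) * z i"
    if "i \<in> {0..N}" for i
    using that by blast+
  have "p_coeff m t N = fps_nth (\<Prod>j<M. p_factor m t (Suc j)) N"
    by (rule M0) (simp add: M_def)
  also have "\<dots> = fps_nth (F * A ^ l ^ k) N"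
    unfolding t prod_p_factor[OF m] F_def A_def ..
  also have "\<dots> = (\<Sum>i=0..N. fps_nth F i * fps_nth (A ^ l ^ k) (N - i))"
    by (rule fps_mult_nth)
  also have "\<dots> = (\<Sum>i=0..N. of_nat (l ^ (k - j + 1)) * z i)"
    by (intro sum.cong refl z)
  also have "\<dots> = of_nat (l ^ (k - j + 1)) * (\<Sum>i=0..N. z i)"
    by (simp only: sum_distrib_left)
  finally show ?thesis
    unfolding t_def by (rule cong_zero_powI) (intro localized_ints_sum z)
qed

section \<open>The Jacobi triple product\<close>

text \<open>Gaussian binomial coefficients by the q-Pascal rule, which needs no division. The
  truncated \<open>n - k\<close> is harmless: for \<open>k > n\<close> it multiplies 0.\<close>

fun qbinomial :: "'a :: comm_ring_1 \<Rightarrow> nat \<Rightarrow> nat \<Rightarrow> 'a" where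
  "qbinomial q n 0 = 1"
| "qbinomial q 0 (Suc k) = 0"
| "qbinomial q (Suc n) (Suc k) = qbinomial q n (Suc k) + q ^ (n - k) * qbinomial q n k"

lemma qbinomial_eq_0: "n < k \<Longrightarrow> qbinomial q n k = 0"
  by (induction q n k rule: qbinomial.induct) auto

lemma choose_two_Suc: "Suc k choose 2 = k + (k choose 2)"
  by (simp add: numeral_2_eq_2)

text \<open>The finite q-binomial theorem: expanding the last factor \<open>y + x * q ^ n\<close>
  reproduces the q-Pascal rule. The form is homogeneous because \<open>y\<close> will be a power of
  \<open>fps_X\<close>, which is not invertible.\<close>

lemma gauss_binomial_formula:
  fixes q x y :: "'a :: comm_ring_1"
  shows "(\<Prod>i<n. y + x * q ^ i) =
    (\<Sum>k\<le>n. q ^ (k choose 2) * qbinomial q n k * x ^ k * y ^ (n - k))"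
proof (induction n)
  case (Suc n)
  define c where "c = (\<lambda>n k. q ^ (k choose 2) * qbinomial q n k * x ^ k * y ^ (n - k))"
  have "(\<Sum>k\<le>Suc n. c (Suc n) k) = c (Suc n) 0 + (\<Sum>k\<le>n. c (Suc n) (Suc k))"
    by (rule sum.atMost_Suc_shift)
  also have "(\<Sum>k\<le>n. c (Suc n) (Suc k)) = (\<Sum>k\<le>n. y * c n (Suc k) + x * q ^ n * c n k)"
  proof (intro sum.cong refl)
    fix k assume k: "k \<in> {..n}"
    have 1: "q ^ (Suc k choose 2) * qbinomial q n (Suc k) * x ^ Suc k * y ^ (n - k) = y * c n (Suc k)"
    \<comment> \<open>At \<open>k = n\<close> the powers of \<open>y\<close> disagree by truncated
      subtraction, but both sides contain \<open>qbinomial q n (Suc n) = 0\<close>.\<close>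
    proof (cases "k = n")
      case True
      thus ?thesis by (simp add: c_def qbinomial_eq_0)
    next
      case False
      with k have "n - k = Suc (n - Suc k)" by auto
      thus ?thesis by (simp add: c_def algebra_simps)
    qed
    have "q ^ (Suc k choose 2) * q ^ (n - k) = q ^ n * q ^ (k choose 2)"
      using k by (simp add: choose_two_Suc add.commute [of n] flip: power_add)
    hence 2: "q ^ (Suc k choose 2) * (q ^ (n - k) * qbinomial q n k) * x ^ Suc k * y ^ (n - k) =
        x * q ^ n * c n k"
      unfolding c_def by (simp add: mult_ac)
    show "c (Suc n) (Suc k) = y * c n (Suc k) + x * q ^ n * c n k"
      unfolding 1[symmetric] 2[symmetric] by (simp add: c_def algebra_simps)
  qed
  also have "c (Suc n) 0 + \<dots> = y * (c n 0 + (\<Sum>k\<le>n. c n (Suc k))) + x * q ^ n * (\<Sum>k\<le>n. c n k)"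
    by (simp add: sum.distrib sum_distrib_left c_def algebra_simps)
  also have "c n 0 + (\<Sum>k\<le>n. c n (Suc k)) = (\<Sum>k\<le>Suc n. c n k)"
    by (rule sum.atMost_Suc_shift [symmetric])
  also have "\<dots> = (\<Sum>k\<le>n. c n k)"
    by (simp add: c_def qbinomial_eq_0)
  finally show ?case
    using Suc.IH by (simp add: c_def algebra_simps)
qed (simp add: numeral_2_eq_2)

lemma euler_prod_Suc: "euler_prod a (Suc n) = euler_prod a n * (1 - fps_X ^ (a * Suc n))"
  by (simp add: euler_prod_def)

text \<open>The quotient formula for Gaussian binomials, cleared of denominators. The two q-Pascal
  summands contribute \<open>1 - Q ^ (n - k')\<close> and \<open>Q ^ (n - k') * (1 - Q ^ k)\<close>
  times \<open>e n\<close>, which add up to \<open>e (Suc n)\<close>.\<close>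

lemma euler_prod_qbinomial:
  "k \<le> n \<Longrightarrow> euler_prod a k * euler_prod a (n - k) * qbinomial (fps_X ^ a) n k = euler_prod a n"
proof (induction n arbitrary: k)
  case (Suc n)
  show ?case
  proof (cases k)
    case 0
    thus ?thesis by (simp add: euler_prod_def)
  next
    case k: (Suc k')
    define e where "e = euler_prod a"
    define Q where "Q = (fps_X ^ a :: rat fps)"
    have e_Suc: "e (Suc n) = e n * (1 - Q ^ Suc n)" for n
      by (simp only: e_def Q_def euler_prod_Suc power_mult)
    have "k' \<le> n" using Suc.prems k by simp
    have IH: "e k' * e (n - k') * qbinomial Q n k' = e n"
      unfolding e_def Q_def using Suc.IH \<open>k' \<le> n\<close> by blast
    have 1: "e k * e (n - k') * qbinomial Q n k = (1 - Q ^ (n - k')) * e n"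
    proof (cases "k' = n")
      case True
      thus ?thesis using k by (simp add: qbinomial_eq_0)
    next
      case False
      hence "n - k' = Suc (n - k)" "k \<le> n" using \<open>k' \<le> n\<close> k by auto
      thus ?thesis
        using Suc.IH[OF \<open>k \<le> n\<close>] by (simp add: e_Suc flip: e_def Q_def) (simp add: mult_ac)
    qed
    have "e k * e (Suc n - k) * qbinomial Q (Suc n) k =
        e k * e (n - k') * qbinomial Q n k + Q ^ (n - k') * (e k * e (n - k') * qbinomial Q n k')"
      by (simp add: k algebra_simps)
    also have "e k * e (n - k') * qbinomial Q n k' = (1 - Q ^ k) * (e k' * e (n - k') * qbinomial Q n k')"
      by (simp only: k e_Suc mult_ac)
    also have "e k * e (n - k') * qbinomial Q n k + Q ^ (n - k') * \<dots> =
        (1 - Q ^ (n - k')) * e n + Q ^ (n - k') * ((1 - Q ^ k) * e n)"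
      by (simp only: 1 IH)
    also have "\<dots> = e n * (1 - Q ^ (n - k') * Q ^ k)"
      by (simp add: algebra_simps)
    also have "Q ^ (n - k') * Q ^ k = Q ^ Suc n"
      using \<open>k' \<le> n\<close> by (simp add: k flip: power_add)
    also have "e n * (1 - Q ^ Suc n) = e (Suc n)"
      by (simp only: e_Suc)
    finally show ?thesis by (simp only: e_def Q_def)
  qed
qed (simp add: euler_prod_def)

text \<open>Every factor after the first \<open>d\<close> is 1 modulo this power.\<close>

lemma euler_prod_tail: "d \<le> n \<Longrightarrow> fps_X ^ (a * Suc d) dvd euler_prod a n - euler_prod a d"
proof (induction n rule: dec_induct)
  case (step n)
  have "fps_X ^ (a * Suc d) dvd (fps_X ^ (a * Suc n) :: rat fps)"
    using step.hyps by (intro le_imp_power_dvd) simp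
  moreover have "euler_prod a (Suc n) - euler_prod a d =
      (euler_prod a n - euler_prod a d) - euler_prod a n * fps_X ^ (a * Suc n)"
    by (simp add: euler_prod_Suc algebra_simps)
  ultimately show ?case
    using step.IH by (metis dvd_diff dvd_mult)
qed auto

lemma euler_prod_nth_0: "a > 0 \<Longrightarrow> fps_nth (euler_prod a n) 0 = 1"
  by (induction n) (simp_all add: euler_prod_Suc, simp add: euler_prod_def)

text \<open>By the quotient formula the product is
  \<open>e n * e (2 * n) / (e k * e (2 * n - k))\<close> with \<open>e = euler_prod a\<close>. All
  four lengths are at least \<open>d\<close>, so each Euler product may be replaced by
  \<open>e d\<close>, which is a unit, and everything cancels.\<close>

lemma euler_prod_times_qbinomial:
  assumes "a > 0" "d \<le> k" "d \<le> n" "k + d \<le> 2 * n"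
  shows "fps_X ^ (a * Suc d) dvd euler_prod a n * qbinomial (fps_X ^ a) (2 * n) k - 1"
proof -
  define X where "X = (fps_X ^ (a * Suc d) :: rat fps)"
  define B where "B = qbinomial (fps_X ^ a :: rat fps) (2 * n) k"
  define e where "e = euler_prod a"
  have t: "X dvd e i - e d" if "d \<le> i" for i
    unfolding X_def e_def by (rule euler_prod_tail[OF that])
  have "X dvd (e k - e d) * (e (2 * n - k) * B) + e d * (e (2 * n - k) - e d) * B
          - (e (2 * n) - e d) - e d * (e n - e d) * B"
    using assms
    by (intro dvd_add dvd_diff dvd_mult2[OF t] dvd_mult2[OF dvd_mult[OF t]] t) simp_all
  also have "\<dots> = e k * e (2 * n - k) * B - e (2 * n) - e d * (e n * B - 1)"
    by (simp add: algebra_simps)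
  also have "e k * e (2 * n - k) * B = e (2 * n)"
    unfolding e_def B_def using assms by (intro euler_prod_qbinomial) auto
  finally have "X dvd e d * (e n * B - 1)" by simp
  hence "X dvd inverse (e d) * (e d * (e n * B - 1))" by (rule dvd_mult)
  also have "\<dots> = inverse (e d) * e d * (e n * B - 1)" by (simp only: mult.assoc)
  also have "inverse (e d) * e d = 1"
    by (rule inverse_mult_eq_1) (simp add: e_def euler_prod_nth_0 assms)
  finally show ?thesis by (simp add: X_def e_def B_def)
qed

lemma fps_X_power_dvd_nth: "fps_X ^ n dvd f \<Longrightarrow> i < n \<Longrightarrow> fps_nth f i = (0 :: 'a :: comm_ring_1)"
  by (auto simp: fps_X_power_mult_nth elim!: dvdE)

text \<open>A truncated Jacobi triple product. For \<open>0 < b < a\<close> the infinite product is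
  the sum of (-1)^r X^(a r (r - 1) / 2 + b r) over all integers r.\<close>

definition triple_prod :: "nat \<Rightarrow> nat \<Rightarrow> nat \<Rightarrow> rat fps" where
  "triple_prod a b n =
    (\<Prod>j<n. (1 - fps_X ^ (a * j + b)) * (1 - fps_X ^ (a * j + (a - b))) * (1 - fps_X ^ (a * j + a)))"

lemma choose_two_times: "2 * int (k choose 2) = int k * (int k - 1)"
  by (induction k) (simp_all add: choose_two_Suc algebra_simps)

lemma prod_lessThan_add:
  fixes f :: "nat \<Rightarrow> 'a :: comm_monoid_mult"
  shows "(\<Prod>i<m + n. f i) = (\<Prod>i<m. f i) * (\<Prod>i<n. f (m + i))"
  by (induction n) (simp_all add: mult.assoc)

text \<open>Gauss's formula at \<open>q = X ^ a\<close>, \<open>x = - X ^ b\<close>, \<open>y = X ^ (a * n)\<close> and length \<open>2 * n\<close> is \<open>X ^ C\<close> times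
  the finite triple product; the \<open>q\<close>-binomial coefficients in it are multiplied to nearly 1 by
  \<open>euler_prod a n\<close>, and \<open>r = k - n\<close> recentres the summation index.\<close>

lemma triple_prod_support:
  assumes ab: "0 < b" "b < a" and i: "i < a * n" and nz: "fps_nth (triple_prod a b n) i \<noteq> 0"
  shows "\<exists>r::int. 2 * int i = int a * r * (r - 1) + 2 * int b * r"
proof -
  define X where "X = (fps_X :: rat fps)"
  define C where "C = b * n + a * (n choose 2) + a * n * n"
  define E where "E = (\<lambda>k. a * (k choose 2) + b * k + a * n * (2 * n - k))"
  define W where "W = (\<lambda>k. euler_prod a n * qbinomial (X ^ a) (2 * n) k)"
  \<comment> \<open>In the first \<open>n\<close> factors \<open>X ^ (b + a * i)\<close> is the
    lower power and is taken out with its sign; in the last \<open>n\<close>, treated in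
    \<open>high\<close>, it is \<open>X ^ (a * n)\<close>. Together they make up
    \<open>X ^ C\<close>.\<close>
  have low: "(\<Prod>i<m. X ^ (a * n) - X ^ b * X ^ (a * i)) =
      (-1) ^ m * X ^ (b * m + a * (m choose 2)) * (\<Prod>i<m. 1 - X ^ (a * (n - i) - b))"
    if "m \<le> n" for m
    using that
  proof (induction m)
    case (Suc m)
    have "a * m + a \<le> a * n"
      using Suc.prems by (metis mult_Suc_right mult_le_mono2 add.commute)
    hence "a * n = (b + a * m) + (a * (n - m) - b)"
      using ab by (simp add: right_diff_distrib')
    hence "X ^ (a * n) = X ^ (b + a * m) * X ^ (a * (n - m) - b)"
      by (simp flip: power_add)
    hence "X ^ (a * n) - X ^ b * X ^ (a * m) = - (X ^ (b + a * m) * (1 - X ^ (a * (n - m) - b)))"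
      by (simp add: power_add algebra_simps)
    thus ?case
      using Suc by (simp add: choose_two_Suc power_add algebra_simps)
  qed (simp add: numeral_2_eq_2)
  have rev: "(\<Prod>i<n. 1 - X ^ (a * (n - i) - b)) = (\<Prod>j<n. 1 - X ^ (a * j + (a - b)))"
  proof -
    have "(\<Prod>i<n. 1 - X ^ (a * (n - i) - b)) = (\<Prod>j<n. 1 - X ^ (a * (n - (n - Suc j)) - b))"
      by (rule prod.nat_diff_reindex [symmetric])
    also have "\<dots> = (\<Prod>j<n. 1 - X ^ (a * j + (a - b)))"
      using ab by (intro prod.cong) (auto simp: add.commute)
    finally show ?thesis .
  qed
  have high: "(\<Prod>i<n. X ^ (a * n) - X ^ b * X ^ (a * (n + i))) =
      X ^ (a * n * n) * (\<Prod>j<n. 1 - X ^ (a * j + b))"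
  proof -
    have "X ^ (a * n) - X ^ b * X ^ (a * (n + i)) = X ^ (a * n) * (1 - X ^ (a * i + b))" for i
      by (simp add: power_add algebra_simps)
    thus ?thesis by (simp add: prod.distrib power_mult)
  qed
  have "(\<Prod>i<2*n. X ^ (a * n) - X ^ b * X ^ (a * i)) =
      (\<Prod>i<n. X ^ (a * n) - X ^ b * X ^ (a * i)) * (\<Prod>i<n. X ^ (a * n) - X ^ b * X ^ (a * (n + i)))"
    unfolding mult_2 by (rule prod_lessThan_add)
  hence L: "(\<Prod>i<2*n. X ^ (a * n) - X ^ b * X ^ (a * i)) * euler_prod a n =
      (-1) ^ n * (X ^ C * triple_prod a b n)"
    unfolding low[OF order.refl] rev high
    by (simp add: C_def triple_prod_def euler_prod_def prod.distrib power_add X_def mult_ac)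
  have "(\<Prod>i<2*n. X ^ (a * n) - X ^ b * X ^ (a * i)) =
      (\<Prod>i<2*n. X ^ (a * n) + (- (X ^ b)) * (X ^ a) ^ i)"
    by (simp add: power_mult)
  also have "\<dots> = (\<Sum>k\<le>2*n. (X ^ a) ^ (k choose 2) * qbinomial (X ^ a) (2 * n) k *
      (- (X ^ b)) ^ k * (X ^ (a * n)) ^ (2 * n - k))"
    by (rule gauss_binomial_formula)
  also have "\<dots> * euler_prod a n = (\<Sum>k\<le>2*n. (-1) ^ k * (X ^ E k * W k))"
    unfolding sum_distrib_right
  proof (intro sum.cong refl)
    fix k
    have "(- (X ^ b)) ^ k = (-1) ^ k * X ^ (b * k)"
      by (metis mult_minus1 power_mult power_mult_distrib)
    thus "(X ^ a) ^ (k choose 2) * qbinomial (X ^ a) (2 * n) k *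
      (- (X ^ b)) ^ k * (X ^ (a * n)) ^ (2 * n - k) * euler_prod a n = (-1) ^ k * (X ^ E k * W k)"
      by (simp add: E_def W_def power_add power_mult mult_ac)
  qed
  finally have *: "(-1) ^ n * (X ^ C * triple_prod a b n) = (\<Sum>k\<le>2*n. (-1) ^ k * (X ^ E k * W k))"
    using L by simp
  have "fps_nth ((-1) ^ n * (X ^ C * triple_prod a b n)) (C + i) \<noteq> 0"
  proof -
    have "fps_nth (X ^ C * triple_prod a b n) (C + i) \<noteq> 0"
      using nz by (simp add: X_def fps_X_power_mult_nth)
    thus ?thesis by (cases "even n") auto
  qed
  hence "(\<Sum>k\<le>2*n. fps_nth ((-1) ^ k * (X ^ E k * W k)) (C + i)) \<noteq> 0"
    unfolding * fps_sum_nth .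
  then obtain k where k: "k \<le> 2 * n" "fps_nth ((-1) ^ k * (X ^ E k * W k)) (C + i) \<noteq> 0"
    by (meson sum.not_neutral_contains_not_neutral atMost_iff)
  hence k2: "fps_nth (X ^ E k * W k) (C + i) \<noteq> 0"
    by (cases "even k") auto
  define r where "r = int k - int n"
  have kr: "int k = int n + r" by (simp add: r_def)
  \<comment> \<open>The equation is doubled to avoid the halves in the binomial
    coefficients.\<close>
  have CE: "2 * (int (E k) - int C) = int a * r * (r - 1) + 2 * int b * r"
  proof -
    have "2 * int C = 2 * int b * int n + int a * (2 * int (n choose 2)) + 2 * int a * int n * int n"
      by (simp add: C_def algebra_simps)
    moreover have diff: "int (2 * n - k) = 2 * int n - int k"
      using k(1) by simp
    have "2 * int (E k) = int a * (2 * int (k choose 2)) + 2 * int b * int k +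
        2 * int a * int n * (2 * int n - int k)"
      unfolding E_def of_nat_add of_nat_mult diff by (simp add: algebra_simps)
    ultimately show ?thesis
      unfolding choose_two_times kr by (simp add: algebra_simps)
  qed
  \<comment> \<open>Since \<open>W k\<close> is 1 modulo \<open>X ^ (a * Suc d)\<close>, the term
    agrees with the monomial \<open>X ^ E k\<close> below degree \<open>C + a * n\<close>, hence at
    degree \<open>C + i\<close>.\<close>
  have "E k = C + i"
  proof (rule ccontr)
    assume neq: "E k \<noteq> C + i"
    define d where "d = min k (2 * n - k)"
    have d: "int d = int n - \<bar>r\<bar>"
      using k(1) by (simp add: d_def r_def)
    have dvd: "X ^ (a * Suc d) dvd W k - 1"
      unfolding W_def X_def
      by (rule euler_prod_times_qbinomial) (use ab k(1) in \<open>auto simp: d_def\<close>)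
    have le: "C + a * n \<le> E k + a * Suc d"
    proof -
      \<comment> \<open>This is the bound doubled and written in \<open>r\<close>. In each case it
        splits into \<open>a\<close> times a product of consecutive integers and a nonnegative
        linear term; for negative \<open>r\<close> the latter uses \<open>b < a\<close>.\<close>
      have "0 \<le> int a * r * (r - 1) + 2 * int b * r + 2 * int a * (1 - \<bar>r\<bar>)"
      proof (cases "r \<ge> 0")
        case True
        have "0 \<le> (r - 1) * (r - 2)"
          by (cases "r \<le> 1") (auto intro: mult_nonpos_nonpos)
        hence "0 \<le> int a * ((r - 1) * (r - 2))" by simp
        moreover have "0 \<le> 2 * int b * r" using True by simp
        moreover have "int a * r * (r - 1) + 2 * int b * r + 2 * int a * (1 - \<bar>r\<bar>) =
            int a * ((r - 1) * (r - 2)) + 2 * int b * r"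
          using True by (simp add: algebra_simps)
        ultimately show ?thesis by linarith
      next
        case False
        have "0 \<le> (- r - 1) * (- r - 2)"
          using False by (cases "r = -1") auto
        hence "0 \<le> int a * ((- r - 1) * (- r - 2))" by simp
        moreover have "0 \<le> 2 * (int a - int b) * (- r)"
          using False ab by (intro mult_nonneg_nonneg) auto
        moreover have "int a * r * (r - 1) + 2 * int b * r + 2 * int a * (1 - \<bar>r\<bar>) =
            int a * ((- r - 1) * (- r - 2)) + 2 * (int a - int b) * (- r)"
          using False by (simp add: algebra_simps)
        ultimately show ?thesis by linarith
      qed
      also have "\<dots> = 2 * (int (E k) - int C) + 2 * int a * (1 + int d - int n)"
        unfolding CE d by simp
      finally have "0 \<le> 2 * (int (E k) - int C) + 2 * int a * (1 + int d - int n)" .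
      hence "int (C + a * n) \<le> int (E k + a * Suc d)"
        by (simp add: algebra_simps)
      thus ?thesis by (simp only: of_nat_le_iff)
    qed
    have "X ^ (E k + a * Suc d) dvd X ^ E k * (W k - 1)"
      unfolding power_add using dvd by (rule mult_dvd_mono[OF dvd_refl])
    hence "fps_nth (X ^ E k * (W k - 1)) (C + i) = 0"
      unfolding X_def by (rule fps_X_power_dvd_nth) (use i le in linarith)
    hence "fps_nth (X ^ E k * W k) (C + i) = fps_nth (X ^ E k) (C + i)"
      by (simp add: right_diff_distrib)
    also have "\<dots> = 0"
      using neq by (simp add: X_def fps_X_power_nth)
    finally show False using k2 by simp
  qed
  thus ?thesis using CE by auto
qed


section \<open>Quadratic forms attached to the exponents of Euler products\<close>

text \<open>Factors after the first \<open>M\<close> are 1 modulo \<open>fps_X ^ M\<close>. The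
  lengths \<open>A\<close> and \<open>B\<close> are independent because the regrouping for
  \<open>m = 2\<close> needs \<open>4 * n\<close> and \<open>2 * n\<close> factors.\<close>

lemma euler_prod_mult_stable:
  assumes "m > 0" "i < M" "M \<le> A" "M \<le> B"
  shows "fps_nth (euler_prod 1 M * euler_prod m M) i = fps_nth (euler_prod 1 A * euler_prod m B) i"
proof -
  have tail: "fps_X ^ M dvd euler_prod c N - euler_prod c M" if "c > 0" "M \<le> N" for c N
  proof -
    have "M \<le> c * Suc M" using that(1) by (cases c) auto
    hence "fps_X ^ M dvd (fps_X ^ (c * Suc M) :: rat fps)" by (rule le_imp_power_dvd)
    thus ?thesis using euler_prod_tail[OF that(2)] by (rule dvd_trans)
  qed
  have "fps_X ^ M dvd (euler_prod 1 A - euler_prod 1 M) * euler_prod m B +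
      euler_prod 1 M * (euler_prod m B - euler_prod m M)"
    using assms by (intro dvd_add dvd_mult dvd_mult2 tail) auto
  also have "\<dots> = euler_prod 1 A * euler_prod m B - euler_prod 1 M * euler_prod m M"
    by (simp add: algebra_simps)
  finally have "fps_nth (euler_prod 1 A * euler_prod m B - euler_prod 1 M * euler_prod m M) i = 0"
    using assms(2) by (rule fps_X_power_dvd_nth)
  thus ?thesis by simp
qed

lemma fps_mult_nth_nonzero:
  fixes f g :: "rat fps"
  assumes "fps_nth (f * g) i \<noteq> 0"
  obtains j where "j \<le> i" "fps_nth f j \<noteq> 0" "fps_nth g (i - j) \<noteq> 0"
proof -
  have "(\<Sum>j=0..i. fps_nth f j * fps_nth g (i - j)) \<noteq> 0"
    using assms by (simp add: fps_mult_nth)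
  then obtain j where "j \<in> {0..i}" "fps_nth f j * fps_nth g (i - j) \<noteq> 0"
    by (rule sum.not_neutral_contains_not_neutral)
  thus thesis by (intro that[of j]) auto
qed

text \<open>Sorting the exponents \<open>m * i\<close> by the residue of \<open>i\<close> modulo 3
  gives the three kinds of factors; this is the pentagonal case of the triple product.\<close>

lemma euler_prod_eq_triple_prod:
  "euler_prod m (3 * n) = triple_prod (3 * m) m n"
proof (induction n)
  case (Suc n)
  have "3 * Suc n = Suc (Suc (Suc (3 * n)))" by simp
  hence "euler_prod m (3 * Suc n) = euler_prod m (3 * n) * ((1 - fps_X ^ (3 * m * n + m)) *
      (1 - fps_X ^ (3 * m * n + (3 * m - m))) * (1 - fps_X ^ (3 * m * n + 3 * m)))"
    by (simp only: euler_prod_Suc) (simp add: algebra_simps)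
  thus ?case by (simp add: Suc.IH triple_prod_def)
qed (simp add: euler_prod_def triple_prod_def)

text \<open>This is \<open>f\<^sub>1 f\<^sub>2 = \<psi>(-q) \<phi>(-q\<^sup>2)\<close> with Gauss's theta series \<open>\<psi>\<close> and \<open>\<phi>\<close>, where \<open>f\<^sub>m\<close> is
  the product of all \<open>1 - q ^ (m * j)\<close>.\<close>

lemma euler_prod_mult_eq_triple_prod:
  "euler_prod 1 (4 * n) * euler_prod 2 (2 * n) = triple_prod 4 1 n * triple_prod 4 2 n"
proof (induction n)
  case (Suc n)
  have Suc_eqs: "4 * Suc n = Suc (Suc (Suc (Suc (4 * n))))" "2 * Suc n = Suc (Suc (2 * n))"
    by simp_all
  have index_eqs: "1 * Suc (4 * n) = 4 * n + 1" "1 * Suc (Suc (4 * n)) = 4 * n + 2"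
      "1 * Suc (Suc (Suc (4 * n))) = 4 * n + (4 - 1)"
      "1 * Suc (Suc (Suc (Suc (4 * n)))) = 4 * n + 4"
      "2 * Suc (2 * n) = 4 * n + 2" "2 * Suc (Suc (2 * n)) = 4 * n + 4" "(4 :: nat) - 2 = 2"
    by simp_all
  \<comment> \<open>The new exponents, written relative to \<open>4 * n\<close>, are 1, 2, 3, 4 and
    2, 4; they regroup as 1, 3, 4 and 2, 2, 4.\<close>
  have "euler_prod 1 (4 * Suc n) * euler_prod 2 (2 * Suc n) =
      (euler_prod 1 (4 * n) * euler_prod 2 (2 * n)) *
      ((1 - fps_X ^ (4 * n + 1)) * (1 - fps_X ^ (4 * n + (4 - 1))) * (1 - fps_X ^ (4 * n + 4))) *
      ((1 - fps_X ^ (4 * n + 2)) * (1 - fps_X ^ (4 * n + (4 - 2))) * (1 - fps_X ^ (4 * n + 4)))"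
    unfolding Suc_eqs euler_prod_Suc index_eqs by (simp only: mult_ac)
  thus ?case
    unfolding Suc.IH by (simp only: triple_prod_def prod.lessThan_Suc mult_ac)
qed (simp add: euler_prod_def triple_prod_def)

text \<open>Completing squares: 2 j = 3 r^2 - r gives 24 j + 1 = (6 r - 1)^2, and the second factor
  gives \<open>m\<close> times such a square.\<close>

lemma euler_prod_support:
  assumes m: "m > 0" and i: "i < M" and nz: "fps_nth (euler_prod 1 M * euler_prod m M) i \<noteq> 0"
  shows "\<exists>x y :: int. int (24 * i + (m + 1)) = x\<^sup>2 + int m * y\<^sup>2"
proof -
  have "fps_nth (euler_prod 1 (3 * M) * euler_prod m (3 * M)) i \<noteq> 0"
    using nz euler_prod_mult_stable[OF m i, of "3 * M" "3 * M"] by simp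
  then obtain j where j: "j \<le> i" "fps_nth (triple_prod (3 * 1) 1 M) j \<noteq> 0"
      "fps_nth (triple_prod (3 * m) m M) (i - j) \<noteq> 0"
    unfolding euler_prod_eq_triple_prod by (rule fps_mult_nth_nonzero)
  have "1 * M \<le> 3 * m * M"
    using m by (intro mult_le_mono1) simp
  hence "i - j < 3 * m * M"
    using i by linarith
  then obtain r' where r': "2 * int (i - j) = int (3 * m) * r' * (r' - 1) + 2 * int m * r'"
    using triple_prod_support[OF _ _ _ j(3)] m by auto
  obtain r where r: "2 * int j = int (3 * 1) * r * (r - 1) + 2 * int 1 * r"
    using triple_prod_support[OF _ _ _ j(2)] j(1) i by auto
  have "int (24 * i + (m + 1)) = 12 * (2 * int j) + 12 * (2 * int (i - j)) + int m + 1"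
    using j(1) by simp
  also have "\<dots> = (6 * r - 1)\<^sup>2 + int m * (6 * r' - 1)\<^sup>2"
    unfolding r r' by (simp add: power2_eq_square algebra_simps)
  finally show ?thesis by blast
qed

text \<open>Completing squares: 2 j = 4 r^2 - 2 r gives 8 j + 1 = (4 r - 1)^2, while the second
  theta series has exponents 2 r'^2.\<close>

lemma euler_prod_1_2_support:
  assumes i: "i < M" and nz: "fps_nth (euler_prod 1 M * euler_prod 2 M) i \<noteq> 0"
  shows "\<exists>x y :: int. int (8 * i + 1) = x\<^sup>2 + y\<^sup>2"
proof -
  have "fps_nth (euler_prod 1 (4 * M) * euler_prod 2 (2 * M)) i \<noteq> 0"
    using nz euler_prod_mult_stable[OF _ i, of 2 "4 * M" "2 * M"] by simp
  then obtain j where j: "j \<le> i" "fps_nth (triple_prod 4 1 M) j \<noteq> 0"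
      "fps_nth (triple_prod 4 2 M) (i - j) \<noteq> 0"
    unfolding euler_prod_mult_eq_triple_prod by (rule fps_mult_nth_nonzero)
  have "i - j < 4 * M"
    using i by simp
  then obtain r' where r': "2 * int (i - j) = int 4 * r' * (r' - 1) + 2 * int 2 * r'"
    using triple_prod_support[OF _ _ _ j(3)] by auto
  obtain r where r: "2 * int j = int 4 * r * (r - 1) + 2 * int 1 * r"
    using triple_prod_support[OF _ _ _ j(2)] j(1) i by auto
  have "int (8 * i + 1) = 4 * (2 * int j) + 4 * (2 * int (i - j)) + 1"
    using j(1) by simp
  also have "\<dots> = (4 * r - 1)\<^sup>2 + (4 * r')\<^sup>2"
    unfolding r r' by (simp add: power2_eq_square algebra_simps)
  finally show ?thesis by blast
qed

section \<open>Values of anisotropic binary forms\<close>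

text \<open>If \<open>y\<close> were invertible modulo \<open>p\<close>, then x / y would be a
  square root of \<open>- D\<close>. The nonresidue condition is put on representatives so that it
  can be evaluated for a given prime.\<close>

lemma prime_dvd_square_plus:
  fixes p D x y :: int
  assumes p: "prime p" and D: "\<forall>z\<in>{0..<p}. \<not> p dvd z\<^sup>2 + D" and dvd: "p dvd x\<^sup>2 + D * y\<^sup>2"
  shows "p dvd x" "p dvd y"
proof -
  have no: "\<not> p dvd z\<^sup>2 + D" for z
  proof
    assume "p dvd z\<^sup>2 + D"
    hence "((z mod p)\<^sup>2 + D) mod p = 0"
      by (metis mod_add_left_eq power_mod mod_0_imp_dvd dvd_imp_mod_0)
    hence "p dvd (z mod p)\<^sup>2 + D" by (rule mod_0_imp_dvd)
    moreover have "z mod p \<in> {0..<p}" using prime_gt_0_int[OF p] by simp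
    ultimately show False using D by blast
  qed
  show y: "p dvd y"
  proof (rule ccontr)
    assume "\<not> p dvd y"
    hence "gcd p y = 1" using p prime_imp_coprime by (simp add: coprime_iff_gcd_eq_1)
    then obtain v u where uv: "v * p + u * y = 1" using bezout_int[of p y] by auto
    have uy: "u * y = 1 - v * p" using uv by simp
    \<comment> \<open>The added multiple of \<open>p\<close> corrects
      \<open>(u * y)\<^sup>2 = (1 - v * p)\<^sup>2\<close> to exactly 1.\<close>
    have "p dvd u\<^sup>2 * (x\<^sup>2 + D * y\<^sup>2) + p * (v * (2 - v * p) * D)"
      using dvd by simp
    also have "\<dots> = (u * x)\<^sup>2 + D * ((u * y)\<^sup>2 + p * (v * (2 - v * p)))"
      by (simp add: power2_eq_square algebra_simps)
    also have "(u * y)\<^sup>2 + p * (v * (2 - v * p)) = 1"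
      unfolding uy by (simp add: power2_eq_square algebra_simps)
    finally show False using no by simp
  qed
  hence "p dvd y\<^sup>2" by (simp add: power2_eq_square)
  hence "p dvd x\<^sup>2" using dvd by (simp add: dvd_add_left_iff)
  thus "p dvd x" using p prime_dvd_power by blast
qed

text \<open>Descent: \<open>p\<close> divides \<open>x\<close> and \<open>y\<close>, so
  \<open>p\<^sup>2\<close> can be cancelled. The odd exponent ends at 1, where the missing factor
  \<open>p\<close> must come from \<open>u\<close>.\<close>

lemma odd_multiplicity_square_plus:
  fixes p D x y u :: int
  assumes p: "prime p" and D: "\<forall>z\<in>{0..<p}. \<not> p dvd z\<^sup>2 + D"
    and eq: "x\<^sup>2 + D * y\<^sup>2 = p ^ Suc (2 * s) * u"
  shows "p dvd u"
  using eq
proof (induction s arbitrary: x y)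
  case (0 x y)
  hence "p dvd x\<^sup>2 + D * y\<^sup>2" by simp
  then obtain x' y' where "x = p * x'" "y = p * y'"
    using prime_dvd_square_plus[OF p D] by (metis dvdE)
  hence "p * (p * (x'\<^sup>2 + D * y'\<^sup>2)) = p * u"
    using 0 by (simp add: power2_eq_square algebra_simps)
  hence "p * (x'\<^sup>2 + D * y'\<^sup>2) = u" using p by auto
  thus ?case by (metis dvd_triv_left)
next
  case (Suc s x y)
  hence "p dvd x\<^sup>2 + D * y\<^sup>2" by simp
  then obtain x' y' where "x = p * x'" "y = p * y'"
    using prime_dvd_square_plus[OF p D] by (metis dvdE)
  hence "p\<^sup>2 * (x'\<^sup>2 + D * y'\<^sup>2) = p\<^sup>2 * (p ^ Suc (2 * s) * u)"
    using Suc.prems by (simp add: power2_eq_square algebra_simps)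
  hence "x'\<^sup>2 + D * y'\<^sup>2 = p ^ Suc (2 * s) * u" using p by auto
  thus ?case by (rule Suc.IH)
qed

section \<open>Congruences along the arithmetic progressions\<close>

text \<open>As \<open>p * p\<close> is 1 modulo \<open>c\<close>, all odd powers of \<open>p\<close>
  are congruent to \<open>p\<close>. Hence the division in the offset of the progression is
  exact.\<close>

lemma mult_div_plus_mod:
  fixes c e f p s :: nat
  assumes "p * p mod c = 1" "e * p mod c = f"
  shows "c * ((e * p ^ Suc (2 * s) - f) div c) + f = e * p ^ Suc (2 * s)"
proof -
  have "e * p ^ Suc (2 * s) = e * p * (p * p) ^ s"
    by (simp add: power_mult power2_eq_square power_mult_distrib)
  hence "e * p ^ Suc (2 * s) mod c = (e * p mod c) * ((p * p mod c) ^ s mod c) mod c"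
    by (simp only: mod_mult_eq power_mod)
  also have "\<dots> = (e * p mod c) mod c"
    by (simp only: assms(1) power_one mod_mult_right_eq mult_1_right)
  also have "\<dots> = f"
    unfolding mod_mod_trivial by (rule assms(2))
  finally have f: "e * p ^ Suc (2 * s) mod c = f" .
  have "c * ((e * p ^ Suc (2 * s) - f) div c) = e * p ^ Suc (2 * s) - f"
    unfolding f [symmetric] by (intro dvd_mult_div_cancel dvd_minus_mod)
  moreover have "f \<le> e * p ^ Suc (2 * s)"
    unfolding f [symmetric] by (rule mod_less_eq_dividend)
  ultimately show ?thesis
    by simp
qed

text \<open>For \<open>i\<close> congruent to the index modulo \<open>p ^ (2 * s)\<close>,
  \<open>h * (c * i + f)\<close> is \<open>p ^ (2 * s - 1)\<close> times a number congruent to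
  \<open>h * (c * r + e)\<close> modulo \<open>p\<close>. By the choice of \<open>r\<close> its
  valuation is odd, so the form does not represent it.\<close>

lemma p_coeff_cong_zero_anisotropic:
  fixes p m b k s n r c e f h D :: nat
  assumes p: "prime p" and m: "m > 0" and s: "s \<ge> 1" "2 * s \<le> k"
    and supp: "\<And>M i. i < M \<Longrightarrow> fps_nth (euler_prod 1 M * euler_prod m M) i \<noteq> 0 \<Longrightarrow>
      \<exists>x y :: int. int (h * (c * i + f)) = x\<^sup>2 + int D * y\<^sup>2"
    and D: "\<forall>z\<in>{0..<int p}. \<not> int p dvd z\<^sup>2 + int D"
    and c: "p * p mod c = 1" "e * p mod c = f"
    and r: "\<not> p dvd h * (c * r + e)"
    and b: "b > 0" "coprime b p"
  shows "cong_zero_pow (p_coeff m (- (of_nat (p ^ k) - of_nat b) / of_nat b)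
    (p ^ (2 * s) * n + p ^ (2 * s - 1) * r + (e * p ^ (2 * s - 1) - f) div c)) p (k - 2 * s + 1)"
proof (rule p_coeff_cong_zero[OF p m b s(2)])
  define N where "N = p ^ (2 * s) * n + p ^ (2 * s - 1) * r + (e * p ^ (2 * s - 1) - f) div c"
  obtain s' where s': "2 * s - 1 = Suc (2 * s')" "2 * s = Suc (Suc (2 * s'))"
    using s(1) by (cases s) auto
  fix M i assume iM: "i < M" and "i \<le> N" "p ^ (2 * s) dvd N - i"
  then obtain w where w: "N = i + p ^ (2 * s) * w"
    by (metis dvdE le_add_diff_inverse)
  show "fps_nth (euler_prod 1 M * euler_prod m M) i = 0"
  proof (rule ccontr)
    assume "fps_nth (euler_prod 1 M * euler_prod m M) i \<noteq> 0"
    from supp[OF iM this] obtain x y :: int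
      where xy: "int (h * (c * i + f)) = x\<^sup>2 + int D * y\<^sup>2" by blast
    define P where "P = p ^ Suc (2 * s')"
    have "c * N + f = c * (P * (p * n)) + c * (P * r) + (c * ((e * P - f) div c) + f)"
      unfolding N_def s' P_def by (simp add: algebra_simps)
    also have "c * ((e * P - f) div c) + f = e * P"
      unfolding P_def by (rule mult_div_plus_mod[OF c])
    finally have "c * i + f + c * (P * (p * w)) = c * (P * (p * n)) + c * (P * r) + e * P"
      unfolding w s' P_def by (simp add: algebra_simps)
    hence "int (c * i + f + c * (P * (p * w))) = int (c * (P * (p * n)) + c * (P * r) + e * P)"
      by (rule arg_cong)
    \<comment> \<open>Integers are needed: \<open>r\<close> is not bounded here, so \<open>w\<close>
      may exceed \<open>n\<close>.\<close>
    hence ci: "int (c * i + f) = int P * (int (c * r + e) + int p * (int c * (int n - int w)))"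
      by (simp add: algebra_simps)
    have "x\<^sup>2 + int D * y\<^sup>2 = int h * int (c * i + f)"
      by (simp only: xy [symmetric] of_nat_mult)
    also have "\<dots> = int p ^ Suc (2 * s') *
        (int (h * (c * r + e)) + int p * (int h * (int c * (int n - int w))))"
      unfolding ci by (simp add: P_def algebra_simps)
    finally have "x\<^sup>2 + int D * y\<^sup>2 = int p ^ Suc (2 * s') *
        (int (h * (c * r + e)) + int p * (int h * (int c * (int n - int w))))" .
    hence "int p dvd int (h * (c * r + e)) + int p * (int h * (int c * (int n - int w)))"
      using odd_multiplicity_square_plus[OF _ D] p by simp
    hence "int p dvd int (h * (c * r + e))"
      by (simp only: dvd_add_left_iff dvd_triv_left)
    thus False using r by (simp only: of_nat_dvd_iff)
  qed
qed

text \<open>The factor \<open>h\<close> is what 24 and \<open>m + 1\<close> have in common in the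
  application, as in 24 i + 3 = 3 (8 i + 1).\<close>

lemma p_coeff_cong_zero_24:
  fixes p m b k s n r c e f h :: nat
  assumes p: "prime p" and m: "m > 0" and s: "s \<ge> 1" "2 * s \<le> k"
    and h: "h * c = 24" "h * f = m + 1"
    and D: "\<forall>z\<in>{0..<int p}. \<not> int p dvd z\<^sup>2 + int m"
    and c: "p * p mod c = 1" "e * p mod c = f"
    and r: "\<not> p dvd h * (c * r + e)"
    and b: "b > 0" "coprime b p"
  shows "cong_zero_pow (p_coeff m (- (of_nat (p ^ k) - of_nat b) / of_nat b)
    (p ^ (2 * s) * n + p ^ (2 * s - 1) * r + (e * p ^ (2 * s - 1) - f) div c)) p (k - 2 * s + 1)"
proof (rule p_coeff_cong_zero_anisotropic[OF p m s _ D c r b])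
  fix M i assume "i < M" "fps_nth (euler_prod 1 M * euler_prod m M) i \<noteq> 0"
  moreover have "h * (c * i + f) = 24 * i + (m + 1)"
    by (simp only: distrib_left mult.assoc [symmetric] h)
  ultimately show "\<exists>x y :: int. int (h * (c * i + f)) = x\<^sup>2 + int m * y\<^sup>2"
    using euler_prod_support[OF m] by metis
qed

theorem theorem1p17:
  fixes k s :: nat
  assumes "k > 1" and "s \<ge> 1" and "int s \<le> \<lfloor>real k / 2\<rfloor>"
  shows
    "(\<forall>b n :: nat. b > 0 \<longrightarrow> coprime b 3 \<longrightarrow> (\<forall>r \<in> {1, 2}.
        cong_zero_pow
          (p_coeff 2 (- (3 ^ k - of_nat b) / of_nat b)
             (3 ^ (2 * s) * n + 3 ^ (2 * s - 1) * r + (3 ^ (2 * s) - 1) div 8))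
          3 (k - 2 * s + 1))) \<and>
     (\<forall>b n :: nat. b > 0 \<longrightarrow> coprime b 5 \<longrightarrow> (\<forall>r \<in> {1, 2, 3, 4}.
        cong_zero_pow
          (p_coeff 2 (- (5 ^ k - of_nat b) / of_nat b)
             (5 ^ (2 * s) * n + 5 ^ (2 * s - 1) * r + (5 ^ (2 * s) - 1) div 8))
          5 (k - 2 * s + 1))) \<and>
     (\<forall>b n :: nat. b > 0 \<longrightarrow> coprime b 7 \<longrightarrow> (\<forall>r \<in> {1..6}.
        cong_zero_pow
          (p_coeff 2 (- (7 ^ k - of_nat b) / of_nat b)
             (7 ^ (2 * s) * n + 7 ^ (2 * s - 1) * r + (7 ^ (2 * s) - 1) div 8))
          7 (k - 2 * s + 1))) \<and>
     (\<forall>b n :: nat. b > 0 \<longrightarrow> coprime b 5 \<longrightarrow> (\<forall>r \<in> {1, 2, 3, 4}.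
        cong_zero_pow
          (p_coeff 3 (- (5 ^ k - of_nat b) / of_nat b)
             (5 ^ (2 * s) * n + 5 ^ (2 * s - 1) * r + (5 ^ (2 * s) - 1) div 6))
          5 (k - 2 * s + 1))) \<and>
     (\<forall>b n :: nat. b > 0 \<longrightarrow> coprime b 7 \<longrightarrow> (\<forall>r \<in> {0} \<union> {2..6}.
        cong_zero_pow
          (p_coeff 4 (- (7 ^ k - of_nat b) / of_nat b)
             (7 ^ (2 * s) * n + 7 ^ (2 * s - 1) * r + (11 * 7 ^ (2 * s - 1) - 5) div 24))
          7 (k - 2 * s + 1))) \<and>
     (\<forall>b n :: nat. b > 0 \<longrightarrow> coprime b 11 \<longrightarrow> (\<forall>r \<in> {0} \<union> {2..10}.
        cong_zero_pow
          (p_coeff 3 (- (11 ^ k - of_nat b) / of_nat b)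
             (11 ^ (2 * s) * n + 11 ^ (2 * s - 1) * r + (5 * 11 ^ (2 * s - 1) - 1) div 6))
          11 (k - 2 * s + 1))) \<and>
     (\<forall>b n :: nat. b > 0 \<longrightarrow> coprime b 11 \<longrightarrow> (\<forall>r \<in> {0, 1} \<union> {3..10}.
        cong_zero_pow
          (p_coeff 4 (- (11 ^ k - of_nat b) / of_nat b)
             (11 ^ (2 * s) * n + 11 ^ (2 * s - 1) * r + (7 * 11 ^ (2 * s - 1) - 5) div 24))
          11 (k - 2 * s + 1)))"
proof -
  have s: "2 * s \<le> k" "s \<ge> 1"
    using assms by linarith+
  \<comment> \<open>This brings the offsets \<open>(p ^ (2 * s) - 1) div c\<close> to the general
    shape with \<open>e = p\<close> and \<open>f = 1\<close>.\<close>
  have pow: "x ^ (2 * s) = x * x ^ (2 * s - 1)" for x :: nat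
    using s(2) by (cases s) auto
  \<comment> \<open>Listing the residues lets simplification decide the nonresidue
    conditions.\<close>
  have residues: "{0..<n} = set [0..n - 1]" for n :: int
    by auto
  have ranges: "{1..6} = {1, 2, 3, 4, 5, 6 :: nat}" "{2..6} = {2, 3, 4, 5, 6 :: nat}"
      "{2..10} = {2, 3, 4, 5, 6, 7, 8, 9, 10 :: nat}" "{3..10} = {3, 4, 5, 6, 7, 8, 9, 10 :: nat}"
    by auto
  show ?thesis
  proof (intro conjI allI impI ballI)
    fix b n r :: nat
    assume b: "b > 0" "coprime b 3" and r: "r \<in> {1, 2}"
    have r': "\<not> 3 dvd 1 * (8 * r + 3)"
      using r unfolding ranges by auto
    show "cong_zero_pow (p_coeff 2 (- (3 ^ k - of_nat b) / of_nat b)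
        (3 ^ (2 * s) * n + 3 ^ (2 * s - 1) * r + (3 ^ (2 * s) - 1) div 8)) 3 (k - 2 * s + 1)"
      \<comment> \<open>The form is x^2 + y^2 with \<open>D = 1\<close>, although
        \<open>m = 2\<close>: x^2 + 2 y^2 represents 3.\<close>
      using p_coeff_cong_zero_anisotropic[of 3 2 s k 1 8 1 1 3 r b n]
        euler_prod_1_2_support s b r'
      by (simp add: residues upto.simps pow)
  next
    fix b n r :: nat
    assume b: "b > 0" "coprime b 5" and r: "r \<in> {1, 2, 3, 4}"
    have r': "\<not> 5 dvd 3 * (8 * r + 5)"
      using r unfolding ranges by auto
    show "cong_zero_pow (p_coeff 2 (- (5 ^ k - of_nat b) / of_nat b)
        (5 ^ (2 * s) * n + 5 ^ (2 * s - 1) * r + (5 ^ (2 * s) - 1) div 8)) 5 (k - 2 * s + 1)"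
      using p_coeff_cong_zero_24[of 5 2 s k 3 8 1 5 r b n] s b r'
      by (simp add: residues upto.simps pow)
  next
    fix b n r :: nat
    assume b: "b > 0" "coprime b 7" and r: "r \<in> {1..6}"
    have r': "\<not> 7 dvd 3 * (8 * r + 7)"
      using r unfolding ranges by auto
    show "cong_zero_pow (p_coeff 2 (- (7 ^ k - of_nat b) / of_nat b)
        (7 ^ (2 * s) * n + 7 ^ (2 * s - 1) * r + (7 ^ (2 * s) - 1) div 8)) 7 (k - 2 * s + 1)"
      using p_coeff_cong_zero_24[of 7 2 s k 3 8 1 7 r b n] s b r'
      by (simp add: residues upto.simps pow)
  next
    fix b n r :: nat
    assume b: "b > 0" "coprime b 5" and r: "r \<in> {1, 2, 3, 4}"
    have r': "\<not> 5 dvd 4 * (6 * r + 5)"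
      using r unfolding ranges by auto
    show "cong_zero_pow (p_coeff 3 (- (5 ^ k - of_nat b) / of_nat b)
        (5 ^ (2 * s) * n + 5 ^ (2 * s - 1) * r + (5 ^ (2 * s) - 1) div 6)) 5 (k - 2 * s + 1)"
      using p_coeff_cong_zero_24[of 5 3 s k 4 6 1 5 r b n] s b r'
      by (simp add: residues upto.simps pow)
  next
    fix b n r :: nat
    assume b: "b > 0" "coprime b 7" and r: "r \<in> {0} \<union> {2..6}"
    \<comment> \<open>Modulo 7 this is 3 r + 4, which vanishes just at the excluded residue
      1.\<close>
    have r': "\<not> 7 dvd 1 * (24 * r + 11)"
      using r unfolding ranges by auto
    show "cong_zero_pow (p_coeff 4 (- (7 ^ k - of_nat b) / of_nat b)
        (7 ^ (2 * s) * n + 7 ^ (2 * s - 1) * r + (11 * 7 ^ (2 * s - 1) - 5) div 24)) 7 (k - 2 * s + 1)"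
      using p_coeff_cong_zero_24[of 7 4 s k 1 24 5 11 r b n] s b r'
      by (simp add: residues upto.simps pow)
  next
    fix b n r :: nat
    assume b: "b > 0" "coprime b 11" and r: "r \<in> {0} \<union> {2..10}"
    have r': "\<not> 11 dvd 4 * (6 * r + 5)"
      using r unfolding ranges by auto
    show "cong_zero_pow (p_coeff 3 (- (11 ^ k - of_nat b) / of_nat b)
        (11 ^ (2 * s) * n + 11 ^ (2 * s - 1) * r + (5 * 11 ^ (2 * s - 1) - 1) div 6)) 11 (k - 2 * s + 1)"
      using p_coeff_cong_zero_24[of 11 3 s k 4 6 1 5 r b n] s b r'
      by (simp add: residues upto.simps pow)
  next
    fix b n r :: nat
    assume b: "b > 0" "coprime b 11" and r: "r \<in> {0, 1} \<union> {3..10}"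
    \<comment> \<open>Modulo 11 this is 2 r + 7, which vanishes just at the excluded residue
      2.\<close>
    have r': "\<not> 11 dvd 1 * (24 * r + 7)"
      using r unfolding ranges by auto
    show "cong_zero_pow (p_coeff 4 (- (11 ^ k - of_nat b) / of_nat b)
        (11 ^ (2 * s) * n + 11 ^ (2 * s - 1) * r + (7 * 11 ^ (2 * s - 1) - 5) div 24)) 11 (k - 2 * s + 1)"
      using p_coeff_cong_zero_24[of 11 4 s k 1 24 5 7 r b n] s b r'
      by (simp add: residues upto.simps pow)
  qed
qed

end
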